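(* For every formula $\alpha\in Fm$, either $\alpha$ is $\mathbf{Six}$-equivalent to $\top$, or to $\bot$, or $\alpha$ is $\mathbf{Six}$-equivalent to a formula $\bigwedge_{i=1}^{n}\bigvee_{j=1}^{m_i}\alpha_{ij}$ ($n\ge0$, $m_i\ge0$) where each $\alpha_{ij}\in\{p_k,\neg p_k,\nabla p_k,\nabla\neg p_k,\neg\nabla p_k,\neg\nabla\neg p_k\}$ for some propositional variable $p_k$. Here $\beta$ and $\gamma$ are $\mathbf{Six}$-equivalent when $\beta\models_{\mathbf{Six}}\gamma$ and $\gamma\models_{\mathbf{Six}}\beta$.
   Context: An involutive Stone algebra is a De Morgan algebra (bounded distributive lattice with $\neg\neg x=x$, $\neg(x\wedge y)=\neg x\vee\neg y$) with a unary $\nabla$ satisfying $\nabla0=0$, $a\wedge\nabla a=a$, $\nabla(a\wedge b)=\nabla a\wedge\nabla b$, $\neg\nabla a\wedge\nabla a=0$; the class is $\mathbf S$. $Fm$ is the set of formulas over a denumerable set of propositional variables built from binary $\wedge,\vee$, unary $\neg,\nabla$ and constants $\bot,\top$; homomorphisms send $\bot\mapsto0,\top\mapsto1$. The logic $\mathbf{Six}$: $\beta\models_{\mathbf{Six}}\gamma$ iff for every $A\in\mathbf S$, every homomorphism $v:\mathfrak{Fm}\to A$ and every $a\in A$, $v(\beta)\ge a$ implies $v(\gamma)\ge a$. *)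

theory Defs
  imports "HOL-Library.Countable_Set"
begin

record 'a alg =
  carrier :: "'a set"
  meet :: "'a \<Rightarrow> 'a \<Rightarrow> 'a"
  join :: "'a \<Rightarrow> 'a \<Rightarrow> 'a"
  neg :: "'a \<Rightarrow> 'a"
  nabla :: "'a \<Rightarrow> 'a"
  zero :: 'a
  one :: 'a

definition le :: "'a alg \<Rightarrow> 'a \<Rightarrow> 'a \<Rightarrow> bool" where
  "le A a b \<longleftrightarrow> meet A a b = a"

locale bounded_distributive_lattice =
  fixes A :: "'a alg"
  assumes meet_closed: "\<lbrakk>a \<in> carrier A; b \<in> carrier A\<rbrakk> \<Longrightarrow> meet A a b \<in> carrier A"
    and join_closed: "\<lbrakk>a \<in> carrier A; b \<in> carrier A\<rbrakk> \<Longrightarrow> join A a b \<in> carrier A"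
    and zero_closed: "zero A \<in> carrier A"
    and one_closed: "one A \<in> carrier A"
    and meet_comm: "\<lbrakk>a \<in> carrier A; b \<in> carrier A\<rbrakk> \<Longrightarrow> meet A a b = meet A b a"
    and join_comm: "\<lbrakk>a \<in> carrier A; b \<in> carrier A\<rbrakk> \<Longrightarrow> join A a b = join A b a"
    and meet_assoc: "\<lbrakk>a \<in> carrier A; b \<in> carrier A; c \<in> carrier A\<rbrakk>
          \<Longrightarrow> meet A (meet A a b) c = meet A a (meet A b c)"
    and join_assoc: "\<lbrakk>a \<in> carrier A; b \<in> carrier A; c \<in> carrier A\<rbrakk>
          \<Longrightarrow> join A (join A a b) c = join A a (join A b c)"
    and meet_join_absorb: "\<lbrakk>a \<in> carrier A; b \<in> carrier A\<rbrakk> \<Longrightarrow> meet A a (join A a b) = a"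
    and join_meet_absorb: "\<lbrakk>a \<in> carrier A; b \<in> carrier A\<rbrakk> \<Longrightarrow> join A a (meet A a b) = a"
    and meet_join_distrib: "\<lbrakk>a \<in> carrier A; b \<in> carrier A; c \<in> carrier A\<rbrakk>
          \<Longrightarrow> meet A a (join A b c) = join A (meet A a b) (meet A a c)"
    and zero_least: "a \<in> carrier A \<Longrightarrow> le A (zero A) a"
    and one_greatest: "a \<in> carrier A \<Longrightarrow> le A a (one A)"

locale de_morgan_algebra = bounded_distributive_lattice A for A :: "'a alg" +
  assumes neg_closed: "a \<in> carrier A \<Longrightarrow> neg A a \<in> carrier A"
    and neg_neg: "a \<in> carrier A \<Longrightarrow> neg A (neg A a) = a"
    and neg_meet: "\<lbrakk>a \<in> carrier A; b \<in> carrier A\<rbrakk>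
          \<Longrightarrow> neg A (meet A a b) = join A (neg A a) (neg A b)"

locale involutive_stone_algebra = de_morgan_algebra A for A :: "'a alg" +
  assumes nabla_closed: "a \<in> carrier A \<Longrightarrow> nabla A a \<in> carrier A"
    and nabla_zero: "nabla A (zero A) = zero A"
    and meet_nabla: "a \<in> carrier A \<Longrightarrow> meet A a (nabla A a) = a"
    and nabla_meet: "\<lbrakk>a \<in> carrier A; b \<in> carrier A\<rbrakk>
          \<Longrightarrow> nabla A (meet A a b) = meet A (nabla A a) (nabla A b)"
    and neg_nabla_meet: "a \<in> carrier A \<Longrightarrow> meet A (neg A (nabla A a)) (nabla A a) = zero A"

datatype fm = Var nat | And fm fm | Or fm fm | Neg fm | Nabla fm | Bot | Top

instance fm :: countable
  by countable_datatype

definition alg_hom :: "'a alg \<Rightarrow> (fm \<Rightarrow> 'a) \<Rightarrow> bool" where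
  "alg_hom A v \<longleftrightarrow>
     range v \<subseteq> carrier A \<and>
     (\<forall>\<phi> \<psi>. v (And \<phi> \<psi>) = meet A (v \<phi>) (v \<psi>)) \<and>
     (\<forall>\<phi> \<psi>. v (Or \<phi> \<psi>) = join A (v \<phi>) (v \<psi>)) \<and>
     (\<forall>\<phi>. v (Neg \<phi>) = neg A (v \<phi>)) \<and>
     (\<forall>\<phi>. v (Nabla \<phi>) = nabla A (v \<phi>)) \<and>
     v Bot = zero A \<and> v Top = one A"

definition six_entails_on :: "'a itself \<Rightarrow> fm \<Rightarrow> fm \<Rightarrow> bool" where
  "six_entails_on _ \<beta> \<gamma> \<longleftrightarrow>
     (\<forall>(A :: 'a alg) v. involutive_stone_algebra A \<longrightarrow> alg_hom A v \<longrightarrow>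
        (\<forall>a \<in> carrier A. le A a (v \<beta>) \<longrightarrow> le A a (v \<gamma>)))"

text \<open>
  HOL cannot quantify over all types inside a formula, so the consequence relation is defined
  through the algebras whose carrier is a subset of nat. The theorems six_entails_sound
  and six_entails_iff below show that this is the relation over algebras of every type
  and cardinality: a refuting valuation has a countable image, which is a subalgebra.
\<close>

definition six_entails :: "fm \<Rightarrow> fm \<Rightarrow> bool" where
  "six_entails = six_entails_on TYPE(nat)"

definition six_equiv :: "fm \<Rightarrow> fm \<Rightarrow> bool" where
  "six_equiv \<beta> \<gamma> \<longleftrightarrow> six_entails \<beta> \<gamma> \<and> six_entails \<gamma> \<beta>"

lemma six_entails_on_transfer:
  assumes six: "six_entails_on TYPE('b) \<beta> \<gamma>" and inf: "infinite (UNIV :: 'b set)"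
  shows "six_entails_on TYPE('a) \<beta> \<gamma>"
  unfolding six_entails_on_def
proof (intro allI impI ballI)
  fix A :: "'a alg" and v a
  assume A: "involutive_stone_algebra A" and v: "alg_hom A v"
    and a: "a \<in> carrier A" and le: "le A a (v \<beta>)"
  interpret involutive_stone_algebra A by (rule A)
  note closed = meet_closed join_closed zero_closed one_closed neg_closed nabla_closed
  have vc: "v \<phi> \<in> carrier A" for \<phi>
    using v by (auto simp: alg_hom_def)
  have vAnd: "meet A (v \<phi>) (v \<psi>) = v (And \<phi> \<psi>)"
    and vOr: "join A (v \<phi>) (v \<psi>) = v (Or \<phi> \<psi>)"
    and vNeg: "neg A (v \<phi>) = v (Neg \<phi>)"
    and vNabla: "nabla A (v \<phi>) = v (Nabla \<phi>)"
    and vBot: "zero A = v Bot" and vTop: "one A = v Top" for \<phi> \<psi>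
    using v by (simp_all add: alg_hom_def)
  obtain h :: "nat \<Rightarrow> 'b" where h: "inj h"
    using infinite_countable_subset[OF inf] by blast
  define f where "f = h \<circ> to_nat_on (range v)"
  have "inj_on f (range v)"
    unfolding f_def by (intro comp_inj_on inj_on_to_nat_on inj_on_subset[OF h]) auto
  define g where "g = inv_into (range v) f"
  have g: "g (f (v \<phi>)) = v \<phi>" for \<phi>
    unfolding g_def using \<open>inj_on f (range v)\<close> by (rule inv_into_f_f) simp
  define B where "B = \<lparr>carrier = f ` range v,
      meet = (\<lambda>x y. f (meet A (g x) (g y))), join = (\<lambda>x y. f (join A (g x) (g y))),
      neg = (\<lambda>x. f (neg A (g x))), nabla = (\<lambda>x. f (nabla A (g x))),
      zero = f (zero A), one = f (one A)\<rparr>"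
  have B: "carrier B = f ` range v"
    "meet B (f (v \<phi>)) (f (v \<psi>)) = f (meet A (v \<phi>) (v \<psi>))"
    "join B (f (v \<phi>)) (f (v \<psi>)) = f (join A (v \<phi>) (v \<psi>))"
    "neg B (f (v \<phi>)) = f (neg A (v \<phi>))"
    "nabla B (f (v \<phi>)) = f (nabla A (v \<phi>))"
    "zero B = f (zero A)" "one B = f (one A)" for \<phi> \<psi>
    by (simp_all add: B_def g)
  note ops = vAnd vOr vNeg vNabla vBot vTop
  note ax = meet_comm[OF vc vc] meet_assoc[OF vc vc vc] join_comm[OF vc vc]
    join_assoc[OF vc vc vc] meet_join_absorb[OF vc vc] join_meet_absorb[OF vc vc]
    meet_join_distrib[OF vc vc vc] zero_least[OF vc, unfolded le_def]
    one_greatest[OF vc, unfolded le_def] neg_neg[OF vc] neg_meet[OF vc vc] nabla_zero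
    meet_nabla[OF vc] nabla_meet[OF vc vc] neg_nabla_meet[OF vc]
  note eqs = ax[unfolded ops]
  have "involutive_stone_algebra B"
    by unfold_locales (auto simp: B ops le_def intro!: arg_cong[of _ _ f] eqs)
  moreover have "alg_hom B (f \<circ> v)"
    by (auto simp: alg_hom_def B ops)
  moreover have "le B (f (v \<beta>)) (f (v \<beta>))"
    using meet_join_absorb[OF vc meet_closed[OF vc vc], of \<beta> \<beta> \<beta>]
    by (simp add: le_def B join_meet_absorb vc)
  ultimately have "le B (f (v \<beta>)) (f (v \<gamma>))"
    using six[unfolded six_entails_on_def, rule_format, of B "f \<circ> v" "f (v \<beta>)"]
    by (simp add: B)
  then have "g (f (meet A (v \<beta>) (v \<gamma>))) = g (f (v \<beta>))"
    by (simp add: le_def B)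
  then have "meet A (v \<beta>) (v \<gamma>) = v \<beta>"
    by (simp only: ops g)
  then show "le A a (v \<gamma>)"
    using le a meet_assoc[OF a vc vc, of \<beta> \<gamma>] by (simp add: le_def)
qed

theorem six_entails_sound:
  "six_entails \<beta> \<gamma> \<Longrightarrow> six_entails_on TYPE('a) \<beta> \<gamma>"
  unfolding six_entails_def by (rule six_entails_on_transfer) auto

theorem six_entails_iff:
  assumes "infinite (UNIV :: 'a set)"
  shows "six_entails \<beta> \<gamma> \<longleftrightarrow> six_entails_on TYPE('a) \<beta> \<gamma>"
  using six_entails_sound[where 'a = 'a] six_entails_on_transfer[OF _ assms]
  unfolding six_entails_def by blast

definition literals :: "nat \<Rightarrow> fm set" where
  "literals k = {Var k, Neg (Var k), Nabla (Var k), Nabla (Neg (Var k)),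
     Neg (Nabla (Var k)), Neg (Nabla (Neg (Var k)))}"

text \<open>
  The empty conjunction is Top and the empty disjunction is Bot; a nonempty one is the iterated
  binary connective, associated to the right, with no added constant.
\<close>

fun big_and :: "fm list \<Rightarrow> fm" where
  "big_and [] = Top"
| "big_and [\<phi>] = \<phi>"
| "big_and (\<phi> # \<psi> # \<phi>s) = And \<phi> (big_and (\<psi> # \<phi>s))"

fun big_or :: "fm list \<Rightarrow> fm" where
  "big_or [] = Bot"
| "big_or [\<phi>] = \<phi>"
| "big_or (\<phi> # \<psi> # \<phi>s) = Or \<phi> (big_or (\<psi> # \<phi>s))"

end

(*
  In an involutive Stone algebra nabla a is a complemented element with complement neg (nabla a),
  so uniqueness of complements gives nabla (neg (nabla a)) = neg (nabla a) and
  nabla (nabla a) = nabla a.  Hence the fixed points of nabla are closed under neg, and by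
  De Morgan under join, which makes nabla distribute over joins.  Both neg and nabla can
  therefore be pushed down to the literals, and up to equivalence the literals are closed under
  both operations; what remains is a lattice combination of literals, which distributivity
  brings into conjunctive normal form.
*)

theory Submission
  imports Defs
begin

section \<open>Bounded distributive lattices: bounds, order, dual distributivity\<close>

context bounded_distributive_lattice
begin

lemma meet_zero: "a \<in> carrier A \<Longrightarrow> meet A a (zero A) = zero A"
  using zero_least[of a] meet_comm[of a "zero A"] zero_closed by (simp add: le_def)

lemma meet_one: "a \<in> carrier A \<Longrightarrow> meet A a (one A) = a"
  using one_greatest[of a] by (simp add: le_def)

lemma join_zero: "a \<in> carrier A \<Longrightarrow> join A a (zero A) = a"
  using join_meet_absorb[of a "zero A"] meet_zero[of a] zero_closed by simp

lemma join_one: "a \<in> carrier A \<Longrightarrow> join A a (one A) = one A"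
  using join_meet_absorb[of "one A" a] meet_one[of a] meet_comm[of a "one A"]
    join_comm[of a "one A"] one_closed by simp

lemma le_iff_join:
  "\<lbrakk>a \<in> carrier A; b \<in> carrier A\<rbrakk> \<Longrightarrow> le A a b \<longleftrightarrow> join A a b = b"
  unfolding le_def
  using join_meet_absorb[of b a] meet_join_absorb[of a b] meet_comm[of a b] join_comm[of a b]
  by auto

lemma le_antisym: "\<lbrakk>a \<in> carrier A; b \<in> carrier A; le A a b; le A b a\<rbrakk> \<Longrightarrow> a = b"
  using meet_comm[of a b] by (simp add: le_def)

lemma le_join1: "\<lbrakk>a \<in> carrier A; b \<in> carrier A\<rbrakk> \<Longrightarrow> le A a (join A a b)"
  by (simp add: le_def meet_join_absorb)

lemma le_join2: "\<lbrakk>a \<in> carrier A; b \<in> carrier A\<rbrakk> \<Longrightarrow> le A b (join A a b)"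
  using le_join1[of b a] join_comm[of a b] by simp

lemma join_least:
  "\<lbrakk>a \<in> carrier A; b \<in> carrier A; c \<in> carrier A; le A a c; le A b c\<rbrakk> \<Longrightarrow> le A (join A a b) c"
  using join_assoc[of a b c] by (simp add: le_iff_join join_closed)

lemma le_trans:
  "\<lbrakk>a \<in> carrier A; b \<in> carrier A; c \<in> carrier A; le A a b; le A b c\<rbrakk> \<Longrightarrow> le A a c"
  using meet_assoc[of a b c] by (simp add: le_def)

text \<open>The locale assumes only distributivity of meet over join. Expanding the right-hand side
  by it produces terms that absorption collapses. This dual form is what disjunctions of conjunctive
  normal forms need.\<close>

lemma join_meet_distrib:
  assumes a: "a \<in> carrier A" and b: "b \<in> carrier A" and c: "c \<in> carrier A"
  shows "join A a (meet A b c) = meet A (join A a b) (join A a c)"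
proof -
  have "meet A (join A a b) (join A a c) = join A (meet A (join A a b) a) (meet A (join A a b) c)"
    by (simp add: meet_join_distrib join_closed a b c)
  also have "meet A (join A a b) a = a"
    using meet_join_absorb[OF a b] meet_comm[OF a join_closed[OF a b]] by simp
  also have "meet A (join A a b) c = join A (meet A a c) (meet A b c)"
    using meet_join_distrib[OF c a b] meet_comm[OF c join_closed[OF a b]]
      meet_comm[OF c a] meet_comm[OF c b] by simp
  also have "join A a (join A (meet A a c) (meet A b c)) = join A a (meet A b c)"
    using join_assoc[OF a meet_closed[OF a c] meet_closed[OF b c]] join_meet_absorb[OF a c] by simp
  finally show ?thesis by simp
qed

text \<open>Half of the uniqueness of complements: expand \<open>a\<close> as the meet of
  \<open>a\<close> with \<open>join A b c\<close>; the part of \<open>a\<close> under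
  \<open>c\<close> vanishes.\<close>

lemma le_complement:
  assumes a: "a \<in> carrier A" and b: "b \<in> carrier A" and c: "c \<in> carrier A"
    and "meet A a c = zero A" and "join A b c = one A"
  shows "le A a b"
  using meet_join_distrib[OF a b c] assms by (simp add: le_def meet_one join_zero meet_closed)

end

section \<open>De Morgan algebras: the dual De Morgan law and the bounds\<close>

context de_morgan_algebra
begin

lemma neg_join:
  assumes a: "a \<in> carrier A" and b: "b \<in> carrier A"
  shows "neg A (join A a b) = meet A (neg A a) (neg A b)"
proof -
  have "neg A (meet A (neg A a) (neg A b)) = join A a b"
    by (simp add: neg_meet neg_closed neg_neg a b)
  then show ?thesis
    by (metis neg_neg meet_closed neg_closed a b)
qed

lemma neg_zero: "neg A (zero A) = one A"
proof -
  \<comment> \<open>Negating this identity puts \<open>neg A (neg A (one A))\<close>, that is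
    \<open>one A\<close>, as a joinand into \<open>neg A (zero A)\<close>.\<close>
  have "meet A (zero A) (neg A (one A)) = zero A"
    using zero_least[OF neg_closed[OF one_closed]] by (simp add: le_def)
  then have "neg A (zero A) = join A (neg A (zero A)) (neg A (neg A (one A)))"
    by (metis neg_meet zero_closed neg_closed one_closed)
  then show ?thesis
    by (simp add: neg_neg one_closed join_one neg_closed zero_closed)
qed

lemma neg_one: "neg A (one A) = zero A"
  using neg_zero neg_neg[OF zero_closed] by simp

end

section \<open>Fixed points of \<open>nabla\<close> and its distribution over joins\<close>

context involutive_stone_algebra
begin

lemma nabla_one: "nabla A (one A) = one A"
  by (metis meet_nabla meet_comm meet_one nabla_closed one_closed)

lemma le_nabla: "a \<in> carrier A \<Longrightarrow> le A a (nabla A a)"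
  by (simp add: le_def meet_nabla)

lemma nabla_mono:
  "\<lbrakk>a \<in> carrier A; b \<in> carrier A; le A a b\<rbrakk> \<Longrightarrow> le A (nabla A a) (nabla A b)"
  using nabla_meet[of a b] by (simp add: le_def)

text \<open>This is the negation of the axiom \<open>neg_nabla_meet\<close>; together they make
  \<open>neg A (nabla A a)\<close> a complement of \<open>nabla A a\<close>.\<close>

lemma neg_nabla_join: "a \<in> carrier A \<Longrightarrow> join A (neg A (nabla A a)) (nabla A a) = one A"
  by (metis neg_meet neg_neg neg_nabla_meet neg_zero join_comm neg_closed nabla_closed)

lemma nabla_neg_nabla:
  assumes a: "a \<in> carrier A"
  shows "nabla A (neg A (nabla A a)) = neg A (nabla A a)"
proof -
  let ?n = "neg A (nabla A a)"
  have c: "nabla A a \<in> carrier A" "?n \<in> carrier A" "nabla A ?n \<in> carrier A"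
    "nabla A (nabla A a) \<in> carrier A"
    by (simp_all add: a nabla_closed neg_closed)
  \<comment> \<open>Apply \<open>nabla\<close> to the axiom \<open>neg_nabla_meet\<close>. Since
    \<open>nabla A a\<close> lies below its own \<open>nabla\<close>, disjointness passes down to
    it, and \<open>le_complement\<close> applies.\<close>
  have "meet A (nabla A ?n) (nabla A (nabla A a)) = zero A"
    using nabla_meet[OF c(2,1)] neg_nabla_meet[OF a] nabla_zero by simp
  then have "meet A (nabla A ?n) (nabla A a) = zero A"
    by (metis c meet_assoc meet_comm meet_nabla meet_zero)
  then have "le A (nabla A ?n) ?n"
    using le_complement[OF c(3,2,1)] neg_nabla_join[OF a] by simp
  then show ?thesis
    using le_nabla[OF c(2)] le_antisym c by blast
qed

lemma nabla_nabla:
  assumes a: "a \<in> carrier A"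
  shows "nabla A (nabla A a) = nabla A a"
proof -
  have c: "nabla A a \<in> carrier A" "neg A (nabla A a) \<in> carrier A"
    by (simp_all add: a nabla_closed neg_closed)
  \<comment> \<open>The previous lemma at the element \<open>neg A (nabla A a)\<close>; using that
    lemma again inside leaves a double negation on both sides.\<close>
  have "nabla A (neg A (nabla A (neg A (nabla A a)))) = neg A (nabla A (neg A (nabla A a)))"
    by (rule nabla_neg_nabla[OF c(2)])
  then show ?thesis
    by (simp add: nabla_neg_nabla[OF a] neg_neg c)
qed

text \<open>The join \<open>?j\<close> is a fixed point of \<open>nabla\<close> above
  \<open>join A a b\<close>, so monotonicity bounds \<open>nabla A (join A a b)\<close> by it. The
  converse inequality is monotonicity on each joinand.\<close>

lemma nabla_join:
  assumes a: "a \<in> carrier A" and b: "b \<in> carrier A"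
  shows "nabla A (join A a b) = join A (nabla A a) (nabla A b)"
proof -
  let ?d = "meet A (neg A (nabla A a)) (neg A (nabla A b))" and ?j = "join A (nabla A a) (nabla A b)"
  have c: "nabla A a \<in> carrier A" "nabla A b \<in> carrier A" "?d \<in> carrier A" "?j \<in> carrier A"
    "join A a b \<in> carrier A" "nabla A (join A a b) \<in> carrier A"
    by (simp_all add: a b nabla_closed neg_closed meet_closed join_closed)
  \<comment> \<open>As \<open>?d\<close> is fixed, its negation \<open>?j\<close> has the form
    \<open>neg A (nabla A ?d)\<close>, to which \<open>nabla_neg_nabla\<close> applies.\<close>
  have "nabla A ?d = ?d"
    by (simp add: nabla_meet nabla_neg_nabla a b nabla_closed neg_closed)
  moreover have "?j = neg A ?d"
    by (simp add: neg_meet neg_neg a b nabla_closed neg_closed)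
  ultimately have j: "nabla A ?j = ?j"
    using nabla_neg_nabla[OF c(3)] by simp
  have "le A (join A a b) ?j"
    by (intro join_least a b c le_trans[OF a c(1) c(4)] le_trans[OF b c(2) c(4)]
        le_nabla le_join1 le_join2)
  then have "le A (nabla A (join A a b)) ?j"
    using nabla_mono[OF c(5,4)] j by simp
  moreover have "le A ?j (nabla A (join A a b))"
    by (intro join_least c nabla_mono le_join1 le_join2 a b)
  ultimately show ?thesis
    by (intro le_antisym c)
qed

end

section \<open>Values of formulas and of conjunctive normal forms under a valuation\<close>

locale isa_valuation = involutive_stone_algebra A for A :: "'a alg" +
  fixes v :: "fm \<Rightarrow> 'a"
  assumes hom: "alg_hom A v"
begin

lemma v_closed [simp]: "v \<phi> \<in> carrier A"
  using hom by (auto simp: alg_hom_def)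

lemma v_simps [simp]:
  "v (And \<phi> \<psi>) = meet A (v \<phi>) (v \<psi>)" "v (Or \<phi> \<psi>) = join A (v \<phi>) (v \<psi>)"
  "v (Neg \<phi>) = neg A (v \<phi>)" "v (Nabla \<phi>) = nabla A (v \<phi>)" "v Bot = zero A" "v Top = one A"
  using hom by (simp_all add: alg_hom_def)

lemmas closed [simp] =
  meet_closed join_closed zero_closed one_closed neg_closed nabla_closed

lemma v_Neg:
  "v (Neg (Neg \<phi>)) = v \<phi>" "v (Neg Bot) = v Top" "v (Neg Top) = v Bot"
  "v (Neg (And \<phi> \<psi>)) = v (Or (Neg \<phi>) (Neg \<psi>))"
  "v (Neg (Or \<phi> \<psi>)) = v (And (Neg \<phi>) (Neg \<psi>))"
  by (simp_all add: neg_neg neg_zero neg_one neg_meet neg_join)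

lemma v_Nabla:
  "v (Nabla (Nabla \<phi>)) = v (Nabla \<phi>)" "v (Nabla (Neg (Nabla \<phi>))) = v (Neg (Nabla \<phi>))"
  "v (Nabla Bot) = v Bot" "v (Nabla Top) = v Top"
  "v (Nabla (And \<phi> \<psi>)) = v (And (Nabla \<phi>) (Nabla \<psi>))"
  "v (Nabla (Or \<phi> \<psi>)) = v (Or (Nabla \<phi>) (Nabla \<psi>))"
  by (simp_all add: nabla_nabla nabla_neg_nabla nabla_zero nabla_one nabla_meet nabla_join)

text \<open>Because singletons have their own clause in \<open>big_and\<close>, a uniform recursion
  holds only for values, where the final \<open>Top\<close> is neutral.\<close>

lemma v_big_and_Cons: "v (big_and (\<phi> # \<phi>s)) = meet A (v \<phi>) (v (big_and \<phi>s))"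
  by (cases \<phi>s) (simp_all add: meet_one)

lemma v_big_or_Cons: "v (big_or (\<phi> # \<phi>s)) = join A (v \<phi>) (v (big_or \<phi>s))"
  by (cases \<phi>s) (simp_all add: join_zero)

lemma v_big_and_append: "v (big_and (\<phi>s @ \<psi>s)) = meet A (v (big_and \<phi>s)) (v (big_and \<psi>s))"
proof (induction \<phi>s)
  case Nil
  show ?case using meet_comm[of "one A" "v (big_and \<psi>s)"] by (simp add: meet_one)
next
  case (Cons \<phi> \<phi>s)
  then show ?case by (simp add: v_big_and_Cons meet_assoc)
qed

lemma v_big_or_append: "v (big_or (\<phi>s @ \<psi>s)) = join A (v (big_or \<phi>s)) (v (big_or \<psi>s))"
proof (induction \<phi>s)
  case Nil
  show ?case using join_comm[of "zero A" "v (big_or \<psi>s)"] by (simp add: join_zero)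
next
  case (Cons \<phi> \<phi>s)
  then show ?case by (simp add: v_big_or_Cons join_assoc)
qed

lemma v_clause_or_cnf:
  "v (big_and (map (\<lambda>\<psi>s. big_or (\<phi>s @ \<psi>s)) \<psi>ss)) =
   join A (v (big_or \<phi>s)) (v (big_and (map big_or \<psi>ss)))"
  by (induction \<psi>ss)
    (simp_all add: join_one v_big_and_Cons v_big_or_append join_meet_distrib)

text \<open>The clauses of the disjunction are all concatenations of a clause from each side. If one
  side has no clauses, neither has the result, matching \<open>join_one\<close>.\<close>

lemma v_cnf_or_cnf:
  "v (big_and (map big_or (concat (map (\<lambda>\<phi>s. map ((@) \<phi>s) \<psi>ss) \<phi>ss)))) =
   join A (v (big_and (map big_or \<phi>ss))) (v (big_and (map big_or \<psi>ss)))"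
proof (induction \<phi>ss)
  case Nil
  show ?case
    using join_comm[of "one A" "v (big_and (map big_or \<psi>ss))"] by (simp add: join_one)
next
  case (Cons \<phi>s \<phi>ss)
  let ?c = "v (big_or \<phi>s)" and ?x = "v (big_and (map big_or \<phi>ss))"
    and ?y = "v (big_and (map big_or \<psi>ss))"
  have "join A (meet A ?c ?x) ?y = meet A (join A ?c ?y) (join A ?x ?y)"
    using join_meet_distrib[of ?y ?c ?x] join_comm[of ?y] by simp
  then show ?case
    using Cons by (simp add: v_big_and_append v_big_and_Cons v_clause_or_cnf comp_def)
qed

end

text \<open>Equality of values is visibly a congruence for all connectives, so it replaces mutual
  entailment during rewriting. The type \<open>nat\<close> matches
  \<open>six_entails\<close>.\<close>

definition isa_eq :: "fm \<Rightarrow> fm \<Rightarrow> bool" where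
  "isa_eq \<phi> \<psi> \<longleftrightarrow> (\<forall>(A :: nat alg) v. isa_valuation A v \<longrightarrow> v \<phi> = v \<psi>)"

lemma isa_eqI: "(\<And>(A :: nat alg) v. isa_valuation A v \<Longrightarrow> v \<phi> = v \<psi>) \<Longrightarrow> isa_eq \<phi> \<psi>"
  by (simp add: isa_eq_def)

lemma isa_eqD: "isa_eq \<phi> \<psi> \<Longrightarrow> isa_valuation (A :: nat alg) v \<Longrightarrow> v \<phi> = v \<psi>"
  by (simp add: isa_eq_def)

lemma isa_eq_sym: "isa_eq \<phi> \<psi> \<Longrightarrow> isa_eq \<psi> \<phi>"
  by (rule isa_eqI, drule (1) isa_eqD, erule sym)

lemma six_entails_if_isa_eq:
  assumes "isa_eq \<phi> \<psi>"
  shows "six_entails \<phi> \<psi>"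
  unfolding six_entails_def six_entails_on_def
proof (intro allI impI ballI)
  fix A :: "nat alg" and v a
  assume "involutive_stone_algebra A" "alg_hom A v" and le: "le A a (v \<phi>)"
  then have "isa_valuation A v"
    by (simp add: isa_valuation_def isa_valuation_axioms_def)
  from isa_eqD[OF assms this] le show "le A a (v \<psi>)" by simp
qed

lemma six_equiv_if_isa_eq: "isa_eq \<phi> \<psi> \<Longrightarrow> six_equiv \<phi> \<psi>"
  unfolding six_equiv_def by (metis six_entails_if_isa_eq isa_eq_sym)

text \<open>The lattice combinations of literals and constants, closed under \<open>isa_eq\<close>
  so that every rewriting step stays inside the set.\<close>

inductive reducible :: "fm \<Rightarrow> bool" where
  literal: "\<phi> \<in> literals k \<Longrightarrow> reducible \<phi>"
| bot: "reducible Bot"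
| top: "reducible Top"
| conj: "reducible \<phi> \<Longrightarrow> reducible \<psi> \<Longrightarrow> reducible (And \<phi> \<psi>)"
| disj: "reducible \<phi> \<Longrightarrow> reducible \<psi> \<Longrightarrow> reducible (Or \<phi> \<psi>)"
| equiv: "reducible \<phi> \<Longrightarrow> isa_eq \<psi> \<phi> \<Longrightarrow> reducible \<psi>"

lemma reducible_literals:
  "reducible (Var k)" "reducible (Neg (Var k))" "reducible (Nabla (Var k))"
  "reducible (Nabla (Neg (Var k)))" "reducible (Neg (Nabla (Var k)))"
  "reducible (Neg (Nabla (Neg (Var k))))"
  by (rule reducible.literal[of _ k], simp add: literals_def)+

lemma isa_eq_Neg:
  "isa_eq (Neg (Neg \<phi>)) \<phi>" "isa_eq (Neg Bot) Top" "isa_eq (Neg Top) Bot"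
  "isa_eq (Neg (And \<phi> \<psi>)) (Or (Neg \<phi>) (Neg \<psi>))"
  "isa_eq (Neg (Or \<phi> \<psi>)) (And (Neg \<phi>) (Neg \<psi>))"
  by (rule isa_eqI, erule isa_valuation.v_Neg)+

lemma isa_eq_Nabla:
  "isa_eq (Nabla (Nabla \<phi>)) (Nabla \<phi>)" "isa_eq (Nabla (Neg (Nabla \<phi>))) (Neg (Nabla \<phi>))"
  "isa_eq (Nabla Bot) Bot" "isa_eq (Nabla Top) Top"
  "isa_eq (Nabla (And \<phi> \<psi>)) (And (Nabla \<phi>) (Nabla \<psi>))"
  "isa_eq (Nabla (Or \<phi> \<psi>)) (Or (Nabla \<phi>) (Nabla \<psi>))"
  by (rule isa_eqI, erule isa_valuation.v_Nabla)+

text \<open>Negation pairs off the six literals up to double negation, and De Morgan exchanges the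
  two lattice rules.\<close>

lemma reducible_Neg: "reducible \<phi> \<Longrightarrow> reducible (Neg \<phi>)"
proof (induction rule: reducible.induct)
  case (literal \<phi> k)
  then show ?case
    by (auto simp: literals_def reducible_literals reducible.equiv[OF _ isa_eq_Neg(1)])
next
  case (equiv \<phi> \<psi>)
  have "isa_eq (Neg \<psi>) (Neg \<phi>)"
    by (intro isa_eqI) (simp add: isa_valuation.v_simps isa_eqD[OF equiv.hyps(2)])
  then show ?case using equiv.IH reducible.equiv by blast
next
  case bot
  show ?case by (rule reducible.equiv[OF reducible.top isa_eq_Neg(2)])
next
  case top
  show ?case by (rule reducible.equiv[OF reducible.bot isa_eq_Neg(3)])
next
  case (conj \<phi> \<psi>)
  show ?case by (rule reducible.equiv[OF reducible.disj[OF conj.IH] isa_eq_Neg(4)])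
next
  case (disj \<phi> \<psi>)
  show ?case by (rule reducible.equiv[OF reducible.conj[OF disj.IH] isa_eq_Neg(5)])
qed

text \<open>\<open>Nabla\<close> sends \<open>Var k\<close> and \<open>Neg (Var k)\<close> to
  literals and fixes the other four up to \<open>isa_eq\<close>.\<close>

lemma reducible_Nabla: "reducible \<phi> \<Longrightarrow> reducible (Nabla \<phi>)"
proof (induction rule: reducible.induct)
  case (literal \<phi> k)
  then show ?case
    by (auto simp: literals_def reducible_literals reducible.equiv[OF _ isa_eq_Nabla(1)]
        reducible.equiv[OF _ isa_eq_Nabla(2)])
next
  case (equiv \<phi> \<psi>)
  have "isa_eq (Nabla \<psi>) (Nabla \<phi>)"
    by (intro isa_eqI) (simp add: isa_valuation.v_simps isa_eqD[OF equiv.hyps(2)])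
  then show ?case using equiv.IH reducible.equiv by blast
next
  case bot
  show ?case by (rule reducible.equiv[OF reducible.bot isa_eq_Nabla(3)])
next
  case top
  show ?case by (rule reducible.equiv[OF reducible.top isa_eq_Nabla(4)])
next
  case (conj \<phi> \<psi>)
  show ?case by (rule reducible.equiv[OF reducible.conj[OF conj.IH] isa_eq_Nabla(5)])
next
  case (disj \<phi> \<psi>)
  show ?case by (rule reducible.equiv[OF reducible.disj[OF disj.IH] isa_eq_Nabla(6)])
qed

lemma reducible_fm: "reducible \<phi>"
  by (induction \<phi>) (auto intro: reducible_literals reducible.intros(2-5) reducible_Neg reducible_Nabla)

section \<open>Conjunctive normal forms as lists of clauses\<close>

lemma cnf_exists:
  "reducible \<phi> \<Longrightarrow>
   \<exists>\<phi>ss. (\<forall>\<phi>s \<in> set \<phi>ss. set \<phi>s \<subseteq> (\<Union>k. literals k)) \<and> isa_eq \<phi> (big_and (map big_or \<phi>ss))"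
proof (induction rule: reducible.induct)
  case (literal \<phi> k)
  then show ?case by (intro exI[of _ "[[\<phi>]]"]) (auto simp: isa_eq_def)
next
  case bot
  \<comment> \<open>One empty clause evaluates to \<open>Bot\<close>; below, no clause at all gives
    \<open>Top\<close>.\<close>
  show ?case by (intro exI[of _ "[[]]"]) (simp add: isa_eq_def)
next
  case top
  show ?case by (intro exI[of _ "[]"]) (simp add: isa_eq_def)
next
  case (conj \<phi> \<psi>)
  then obtain \<phi>ss \<psi>ss where
    lits: "\<forall>\<phi>s \<in> set (\<phi>ss @ \<psi>ss). set \<phi>s \<subseteq> (\<Union>k. literals k)"
    and eqs: "isa_eq \<phi> (big_and (map big_or \<phi>ss))" "isa_eq \<psi> (big_and (map big_or \<psi>ss))"
    by (metis UnE set_append)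
  have "isa_eq (And \<phi> \<psi>) (big_and (map big_or (\<phi>ss @ \<psi>ss)))"
  proof (rule isa_eqI)
    fix A :: "nat alg" and v assume v: "isa_valuation A v"
    then interpret isa_valuation A v .
    show "v (And \<phi> \<psi>) = v (big_and (map big_or (\<phi>ss @ \<psi>ss)))"
      by (simp add: v_big_and_append isa_eqD[OF eqs(1) v] isa_eqD[OF eqs(2) v])
  qed
  with lits show ?case by blast
next
  case (disj \<phi> \<psi>)
  then obtain \<phi>ss \<psi>ss where
    lits: "\<forall>\<phi>s \<in> set \<phi>ss. set \<phi>s \<subseteq> (\<Union>k. literals k)" "\<forall>\<psi>s \<in> set \<psi>ss. set \<psi>s \<subseteq> (\<Union>k. literals k)"
    and eqs: "isa_eq \<phi> (big_and (map big_or \<phi>ss))" "isa_eq \<psi> (big_and (map big_or \<psi>ss))"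
    by blast
  let ?\<chi>ss = "concat (map (\<lambda>\<phi>s. map ((@) \<phi>s) \<psi>ss) \<phi>ss)"
  have "isa_eq (Or \<phi> \<psi>) (big_and (map big_or ?\<chi>ss))"
  proof (rule isa_eqI)
    fix A :: "nat alg" and v assume v: "isa_valuation A v"
    then interpret isa_valuation A v .
    show "v (Or \<phi> \<psi>) = v (big_and (map big_or ?\<chi>ss))"
      by (simp only: v_cnf_or_cnf v_simps isa_eqD[OF eqs(1) v] isa_eqD[OF eqs(2) v])
  qed
  moreover have "\<forall>\<chi>s \<in> set ?\<chi>ss. set \<chi>s \<subseteq> (\<Union>k. literals k)"
    using lits by fastforce
  ultimately show ?case by blast
next
  case (equiv \<phi> \<psi>)
  then show ?case unfolding isa_eq_def by metis
qed

text \<open>Translates indexing from 1 into list positions from 0. Deleting \<open>upt_Suc\<close>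
  keeps the interval whole for \<open>nth\<close>.\<close>

lemma map_nth_pred: "map (\<lambda>i. f (xs ! (i - 1))) [1..<length xs + 1] = map f xs"
  by (rule nth_equalityI) (simp_all del: upt_Suc)

theorem mainTheorem15:
  fixes \<alpha> :: fm
  shows "six_equiv \<alpha> Top \<or> six_equiv \<alpha> Bot \<or>
    (\<exists>(n :: nat) (m :: nat \<Rightarrow> nat) (l :: nat \<Rightarrow> nat \<Rightarrow> fm).
       (\<forall>i \<in> {1..n}. \<forall>j \<in> {1..m i}. \<exists>k. l i j \<in> literals k) \<and>
       six_equiv \<alpha> (big_and (map (\<lambda>i. big_or (map (\<lambda>j. l i j) [1..<m i + 1])) [1..<n + 1])))"
proof -
  \<comment> \<open>The lists cover the constants too, so the third alternative is established for
    every formula.\<close>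
  obtain \<phi>ss where lits: "\<forall>\<phi>s \<in> set \<phi>ss. set \<phi>s \<subseteq> (\<Union>k. literals k)"
    and eq: "isa_eq \<alpha> (big_and (map big_or \<phi>ss))"
    using cnf_exists[OF reducible_fm] by blast
  define m where "m = (\<lambda>i. length (\<phi>ss ! (i - 1)))"
  define l where "l = (\<lambda>i j. \<phi>ss ! (i - 1) ! (j - 1))"
  have "\<exists>k. l i j \<in> literals k" if "i \<in> {1..length \<phi>ss}" "j \<in> {1..m i}" for i j
  proof -
    have "\<phi>ss ! (i - 1) \<in> set \<phi>ss"
      using that by (intro nth_mem) auto
    moreover have "l i j \<in> set (\<phi>ss ! (i - 1))"
      unfolding l_def using that by (intro nth_mem) (auto simp: m_def)
    ultimately show ?thesis using lits by blast
  qed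
  moreover have "map (\<lambda>i. big_or (map (\<lambda>j. l i j) [1..<m i + 1])) [1..<length \<phi>ss + 1]
      = map big_or \<phi>ss"
    \<comment> \<open>With the identity, \<open>map_nth_pred\<close> rebuilds each clause; with
      \<open>big_or\<close> it then rebuilds the outer list.\<close>
    unfolding l_def m_def map_nth_pred[where f = "\<lambda>x. x"] list.map_ident
    by (rule map_nth_pred)
  ultimately show ?thesis
    using six_equiv_if_isa_eq[OF eq] by (metis (no_types, lifting))
qed

end
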